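(* For every $n\geqslant1$, as an identity of rational functions, $$Q_n(x,y,z,p,q,r,s,t)=\left(\frac{x+y+z}{3}\right)^nQ_n\left(1,1,1,\frac{3xyp}{x+y+z},\frac{3xzq}{x+y+z},\frac{3yzr}{x+y+z},\frac{s(x+y+z)^2}{9xyz},\frac{3t}{x+y+z}\right).$$ Consequently, with $C_n(x,y,z)=\sum_{\sigma\in\mathcal{Q}_n}x^{\mathrm{asc}(\sigma)}y^{\mathrm{plat}(\sigma)}z^{\mathrm{des}(\sigma)}$, $$C_n(x,y,z)=\sum_{\sigma\in\mathcal{Q}_n}(xy)^{\mathrm{lap}(\sigma)}(xz)^{\mathrm{eud}(\sigma)}(yz)^{\mathrm{rpd}(\sigma)}(xyz)^{-\mathrm{apd}(\sigma)}\left(\frac{x+y+z}{3}\right)^{\alpha_n(\sigma)},$$ where $\alpha_n(\sigma)=n+2\,\mathrm{apd}(\sigma)-\mathrm{lap}(\sigma)-\mathrm{eud}(\sigma)-\mathrm{rpd}(\sigma)-\mathrm{vv}(\sigma)$.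
   Context: A Stirling permutation of order $n$ is a word $\sigma=\sigma_1\cdots\sigma_{2n}$ on the multiset $\{1,1,\ldots,n,n\}$ such that whenever $\sigma_i=\sigma_j$ with $i<j$, $\sigma_s>\sigma_i$ for all $i<s<j$; $\mathcal{Q}_n$ is the set of these. Convention: $\sigma_0=\sigma_{2n+1}=0$. Each statistic counts the values $v\in[n]$ with the stated property (positions $i<j$ denote the two occurrences of $v$ where relevant): $\mathrm{asc}$: $v=\sigma_i$ with $\sigma_{i-1}<\sigma_i$; $\mathrm{plat}$: $v=\sigma_i$ with $\sigma_i=\sigma_{i+1}$; $\mathrm{des}$: $v=\sigma_i$ with $\sigma_i>\sigma_{i+1}$; $\mathrm{lap}$: $v=\sigma_i$ with $\sigma_{i-1}<\sigma_i=\sigma_{i+1}$; $\mathrm{rpd}$: $v=\sigma_i$ with $\sigma_{i-1}=\sigma_i>\sigma_{i+1}$; $\mathrm{eud}$: $\sigma_{i-1}<\sigma_i$ and $\sigma_j>\sigma_{j+1}$; $\mathrm{apd}$: $v=\sigma_i$ with $\sigma_{i-1}<\sigma_i=\sigma_{i+1}>\sigma_{i+2}$; $\mathrm{vv}$: $\sigma_{i-1}>\sigma_i<\sigma_{i+1}$ and $\sigma_{j-1}>\sigma_j<\sigma_{j+1}$. $Q_n(x,y,z,p,q,r,s,t)=\sum_{\sigma\in\mathcal{Q}_n}x^{\mathrm{asc}(\sigma)}y^{\mathrm{plat}(\sigma)}z^{\mathrm{des}(\sigma)}p^{\mathrm{lap}(\sigma)}q^{\mathrm{eud}(\sigma)}r^{\mathrm{rpd}(\sigma)}s^{\mathrm{apd}(\sigma)}t^{\mathrm{vv}(\sigma)}$.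 *)

theory Defs
  imports Complex_Main "HOL-Library.Multiset"
begin

text \<open>
  Words are lists of natural numbers, but positions are counted from 1, and the word is
  padded by 0 on both sides: \<open>letter w 0 = 0\<close> and \<open>letter w (length w + 1) = 0\<close>.
\<close>

definition letter :: "nat list \<Rightarrow> nat \<Rightarrow> nat" where
  "letter w i = (if 1 \<le> i \<and> i \<le> length w then w ! (i - 1) else 0)"

definition stirling_perms :: "nat \<Rightarrow> nat list set" where
  "stirling_perms n =
     {w. mset w = mset_set {1..n} + mset_set {1..n} \<and>
         (\<forall>i\<in>{1..2*n}. \<forall>j\<in>{1..2*n}. i < j \<and> letter w i = letter w j \<longrightarrow>
            (\<forall>k. i < k \<and> k < j \<longrightarrow> letter w k > letter w i))}"

text \<open>
  Every statistic is a number of values, not of positions. For a Stirling permutation of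
  order \<open>n\<close>, \<open>set w\<close> is \<open>{1..n}\<close>.
\<close>

definition asc :: "nat list \<Rightarrow> nat" where
  "asc w = card {v \<in> set w. \<exists>i\<in>{1..length w}. letter w i = v \<and>
     letter w (i - 1) < letter w i}"

definition plat :: "nat list \<Rightarrow> nat" where
  "plat w = card {v \<in> set w. \<exists>i\<in>{1..length w}. letter w i = v \<and>
     letter w i = letter w (i + 1)}"

definition des :: "nat list \<Rightarrow> nat" where
  "des w = card {v \<in> set w. \<exists>i\<in>{1..length w}. letter w i = v \<and>
     letter w i > letter w (i + 1)}"

definition lap :: "nat list \<Rightarrow> nat" where
  "lap w = card {v \<in> set w. \<exists>i\<in>{1..length w}. letter w i = v \<and>
     letter w (i - 1) < letter w i \<and> letter w i = letter w (i + 1)}"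

definition rpd :: "nat list \<Rightarrow> nat" where
  "rpd w = card {v \<in> set w. \<exists>i\<in>{1..length w}. letter w i = v \<and>
     letter w (i - 1) = letter w i \<and> letter w i > letter w (i + 1)}"

definition eud :: "nat list \<Rightarrow> nat" where
  "eud w = card {v \<in> set w. \<exists>i\<in>{1..length w}. \<exists>j\<in>{1..length w}.
     i < j \<and> letter w i = v \<and> letter w j = v \<and>
     letter w (i - 1) < letter w i \<and> letter w j > letter w (j + 1)}"

definition apd :: "nat list \<Rightarrow> nat" where
  "apd w = card {v \<in> set w. \<exists>i\<in>{1..length w}. letter w i = v \<and>
     letter w (i - 1) < letter w i \<and> letter w i = letter w (i + 1) \<and>
     letter w (i + 1) > letter w (i + 2)}"

definition vv :: "nat list \<Rightarrow> nat" where
  "vv w = card {v \<in> set w. \<exists>i\<in>{1..length w}. \<exists>j\<in>{1..length w}.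
     i < j \<and> letter w i = v \<and> letter w j = v \<and>
     letter w (i - 1) > letter w i \<and> letter w i < letter w (i + 1) \<and>
     letter w (j - 1) > letter w j \<and> letter w j < letter w (j + 1)}"

definition Q_poly :: "nat \<Rightarrow> 'a::field_char_0 \<Rightarrow> 'a \<Rightarrow> 'a \<Rightarrow> 'a \<Rightarrow> 'a \<Rightarrow> 'a \<Rightarrow> 'a \<Rightarrow> 'a \<Rightarrow> 'a" where
  "Q_poly n x y z p q r s t = (\<Sum>w\<in>stirling_perms n.
     x ^ asc w * y ^ plat w * z ^ des w * p ^ lap w * q ^ eud w * r ^ rpd w * s ^ apd w * t ^ vv w)"

definition C_poly :: "nat \<Rightarrow> 'a::field_char_0 \<Rightarrow> 'a \<Rightarrow> 'a \<Rightarrow> 'a" where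
  "C_poly n x y z = (\<Sum>w\<in>stirling_perms n. x ^ asc w * y ^ plat w * z ^ des w)"

definition alpha :: "nat \<Rightarrow> nat list \<Rightarrow> int" where
  "alpha n w = int n + 2 * int (apd w) - int (lap w) - int (eud w) - int (rpd w) - int (vv w)"

lemma finite_stirling_perms: "finite (stirling_perms n)"
proof -
  obtain u where "mset u = mset_set {1..n} + mset_set {1..n}"
    using ex_mset by blast
  then have "stirling_perms n \<subseteq> {w. mset w = mset u}"
    by (auto simp: stirling_perms_def)
  then show ?thesis
    using mset_eq_finite finite_subset by blast
qed

lemma set_stirling_perm:
  assumes "w \<in> stirling_perms n"
  shows "set w = {1..n}"
proof -
  have "mset w = mset_set {1..n} + mset_set {1..n}"
    using assms by (simp add: stirling_perms_def)
  then have "set_mset (mset w) = {1..n}" by simp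
  then show ?thesis by simp
qed

text \<open>
  An identity of rational functions over the rationals is expressed by letting the variables
  range over the elements of an arbitrary field of characteristic 0 at which no denominator
  vanishes. The type of the field may in particular be a field of fractions of iterated
  polynomials such as \<open>rat poly poly fract\<close> (with as many variables as required), and the
  variables may be its indeterminates.
\<close>

end

theory Submission
  imports Defs "HOL-Library.Sublist"
begin

text \<open>
  Cutting a Stirling word at its least letter \<open>m\<close> into \<open>u m v m x\<close> exhibits it as the traversal of an
  increasing ternary tree with root \<open>m\<close> and subtrees \<open>u\<close>, \<open>v\<close>, \<open>x\<close>. A letter is an ascent, a plateau
  or a descent iff the first, the second or the third subtree of its node is empty, and the other
  five statistics are Boolean combinations of these three conditions. The generating function of
  the trees on a label set therefore satisfies a recursion in which the root contributes a weight
  depending only on which subtrees are empty. Rotating the three subtrees shows that only the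
  cyclic sums of the weights matter; in particular \<open>x\<close>, \<open>y\<close>, \<open>z\<close> may each be replaced by their mean
  at the nodes with exactly one empty subtree, and at all other nodes both sides of the identity
  have the same weight.
\<close>

section \<open>The type of a letter, read off from its two occurrences\<close>

definition asc_at :: "nat list \<Rightarrow> nat \<Rightarrow> bool" where
  "asc_at w a \<longleftrightarrow> (\<exists>i\<in>{1..length w}. letter w i = a \<and> letter w (i - 1) < letter w i)"

definition plat_at :: "nat list \<Rightarrow> nat \<Rightarrow> bool" where
  "plat_at w a \<longleftrightarrow> (\<exists>i\<in>{1..length w}. letter w i = a \<and> letter w i = letter w (i + 1))"

definition des_at :: "nat list \<Rightarrow> nat \<Rightarrow> bool" where
  "des_at w a \<longleftrightarrow> (\<exists>i\<in>{1..length w}. letter w i = a \<and> letter w i > letter w (i + 1))"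

text \<open>The letters of \<open>u\<close> and \<open>x\<close> may lie on either side of
  \<open>a\<close>, so that every letter of a Stirling word, not only the least one, has such a
  splitting. The condition \<open>0 < a\<close> separates \<open>a\<close> from the padding.\<close>

definition split_at :: "nat \<Rightarrow> nat list \<Rightarrow> nat list \<Rightarrow> nat list \<Rightarrow> bool" where
  "split_at a u v x \<longleftrightarrow> 0 < a \<and> a \<notin> set u \<and> a \<notin> set x \<and> (\<forall>b\<in>set v. a < b)"

text \<open>The outer neighbours of the two copies of \<open>a\<close> differ from \<open>a\<close>;
  the inner ones equal \<open>a\<close> if \<open>v\<close> is empty and exceed it otherwise. Hence
  an ascent can occur only at the first copy and a descent only at the second, and each remaining
  statistic is a Boolean combination of the three types.\<close>

lemma types_split:
  assumes sp: "split_at a u v x" and w: "w = u @ a # v @ a # x"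
  shows "asc_at w a \<longleftrightarrow> last (0 # u) < a"
    and "plat_at w a \<longleftrightarrow> v = []"
    and "des_at w a \<longleftrightarrow> hd (x @ [0]) < a"
    and "(\<exists>i\<in>{1..length w}. letter w i = a \<and> letter w (i - 1) < letter w i \<and>
      letter w i = letter w (i + 1)) \<longleftrightarrow> asc_at w a \<and> plat_at w a"
    and "(\<exists>i\<in>{1..length w}. letter w i = a \<and> letter w (i - 1) = letter w i \<and>
      letter w i > letter w (i + 1)) \<longleftrightarrow> plat_at w a \<and> des_at w a"
    and "(\<exists>i\<in>{1..length w}. \<exists>j\<in>{1..length w}. i < j \<and> letter w i = a \<and> letter w j = a \<and>
      letter w (i - 1) < letter w i \<and> letter w j > letter w (j + 1)) \<longleftrightarrow>
      asc_at w a \<and> des_at w a"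
    and "(\<exists>i\<in>{1..length w}. letter w i = a \<and> letter w (i - 1) < letter w i \<and>
      letter w i = letter w (i + 1) \<and> letter w (i + 1) > letter w (i + 2)) \<longleftrightarrow>
      asc_at w a \<and> plat_at w a \<and> des_at w a"
    and "(\<exists>i\<in>{1..length w}. \<exists>j\<in>{1..length w}. i < j \<and> letter w i = a \<and> letter w j = a \<and>
      letter w (i - 1) > letter w i \<and> letter w i < letter w (i + 1) \<and>
      letter w (j - 1) > letter w j \<and> letter w j < letter w (j + 1)) \<longleftrightarrow>
      \<not> asc_at w a \<and> \<not> plat_at w a \<and> \<not> des_at w a"
proof -
  \<comment> \<open>The positions of the two copies of \<open>a\<close>, counted from 1 as in
    \<open>letter\<close>.\<close>
  define i\<^sub>1 i\<^sub>2 where "i\<^sub>1 = Suc (length u)" and "i\<^sub>2 = Suc (Suc (length u + length v))"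
  have "u ! k \<noteq> a" if "k < length u" for k
    using sp nth_mem[OF that] by (auto simp: split_at_def)
  moreover have "v ! k \<noteq> a" if "k < length v" for k
    using sp nth_mem[OF that] by (auto simp: split_at_def)
  moreover have "x ! k \<noteq> a" if "k < length x" for k
    using sp nth_mem[OF that] by (auto simp: split_at_def)
  ultimately have nth: "w ! k = a \<longleftrightarrow> k = length u \<or> k = length u + length v + 1"
    if "k < length w" for k
    using that unfolding w by (auto simp: nth_append nth_Cons')
  have pos: "i \<in> {1..length w} \<and> letter w i = a \<longleftrightarrow> i = i\<^sub>1 \<or> i = i\<^sub>2" for i
    using w nth[of "i - 1"] unfolding i\<^sub>1_def i\<^sub>2_def by (cases i) (auto simp: letter_def)
  have ex: "(\<exists>i\<in>{1..length w}. letter w i = a \<and> P i) \<longleftrightarrow> P i\<^sub>1 \<or> P i\<^sub>2" for P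
  proof -
    have "(\<exists>i\<in>{1..length w}. letter w i = a \<and> P i) \<longleftrightarrow>
      (\<exists>i. (i \<in> {1..length w} \<and> letter w i = a) \<and> P i)" by blast
    then show ?thesis unfolding pos by auto
  qed
  have ex2: "(\<exists>i\<in>{1..length w}. \<exists>j\<in>{1..length w}. i < j \<and> letter w i = a \<and> letter w j = a \<and> P i j)
      \<longleftrightarrow> P i\<^sub>1 i\<^sub>2" (is "?L \<longleftrightarrow> _") for P
  proof
    assume ?L
    then obtain i j where ij: "i \<in> {1..length w} \<and> letter w i = a"
      "j \<in> {1..length w} \<and> letter w j = a" "i < j" "P i j" by blast
    then have "i = i\<^sub>1" "j = i\<^sub>2" unfolding pos by (auto simp: i\<^sub>1_def i\<^sub>2_def)
    with ij show "P i\<^sub>1 i\<^sub>2" by simp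
  next
    assume "P i\<^sub>1 i\<^sub>2"
    moreover have "i\<^sub>1 < i\<^sub>2" by (simp add: i\<^sub>1_def i\<^sub>2_def)
    ultimately show ?L using pos[of i\<^sub>1] pos[of i\<^sub>2] by blast
  qed
  have at: "letter w i\<^sub>1 = a" "letter w i\<^sub>2 = a" using pos by blast+
  \<comment> \<open>The 0 in \<open>last (0 # u)\<close>, and likewise in
    \<open>hd (x @ [0])\<close>, is the padding, met when the outer block is empty.\<close>
  have first: "letter w (i\<^sub>1 - 1) = last (0 # u)"
    by (auto simp: i\<^sub>1_def w letter_def nth_append last_conv_nth Suc_le_eq)
  have last: "letter w (i\<^sub>2 + 1) = hd (x @ [0])"
    by (cases x) (auto simp: i\<^sub>2_def w letter_def nth_append nth_Cons')
  have "letter w (i\<^sub>1 + 1) = hd (v @ [a])"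
    by (cases v) (auto simp: i\<^sub>1_def w letter_def nth_append)
  moreover have "letter w (i\<^sub>2 - 1) = last (a # v)"
    by (auto simp: i\<^sub>2_def w letter_def nth_append last_conv_nth nth_Cons')
  moreover have "v \<noteq> [] \<Longrightarrow> a < hd v \<and> a < last v" using sp by (simp add: split_at_def)
  ultimately have inner: "v = [] \<and> letter w (i\<^sub>1 + 1) = a \<and> letter w (i\<^sub>2 - 1) = a \<or>
      v \<noteq> [] \<and> a < letter w (i\<^sub>1 + 1) \<and> a < letter w (i\<^sub>2 - 1)" by auto
  have "last (0 # u) \<noteq> a" "hd (x @ [0]) \<noteq> a"
    using sp last_in_set[of u] list.set_sel(1)[of x] by (auto simp: split_at_def hd_append)
  then have outer: "letter w (i\<^sub>1 - 1) \<noteq> a" "letter w (i\<^sub>2 + 1) \<noteq> a" unfolding first last .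
  have asc: "asc_at w a \<longleftrightarrow> letter w (i\<^sub>1 - 1) < a"
    unfolding asc_at_def ex at using inner by auto
  have plat: "plat_at w a \<longleftrightarrow> v = []"
    unfolding plat_at_def ex at using inner outer by auto
  have des: "des_at w a \<longleftrightarrow> letter w (i\<^sub>2 + 1) < a"
    unfolding des_at_def ex at using inner by auto
  \<comment> \<open>For \<open>apd\<close>: when the copies are adjacent, two places after the first
    copy is the right neighbour of the second.\<close>
  have adj: "v = [] \<Longrightarrow> i\<^sub>1 + 2 = i\<^sub>2 + 1" by (simp add: i\<^sub>1_def i\<^sub>2_def)
  note types = asc plat des
  show "asc_at w a \<longleftrightarrow> last (0 # u) < a" "plat_at w a \<longleftrightarrow> v = []"
    "des_at w a \<longleftrightarrow> hd (x @ [0]) < a"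
    unfolding types first last by (rule refl)+
  show "(\<exists>i\<in>{1..length w}. letter w i = a \<and> letter w (i - 1) < letter w i \<and>
      letter w i = letter w (i + 1)) \<longleftrightarrow> asc_at w a \<and> plat_at w a"
    unfolding types ex at using inner outer by auto
  show "(\<exists>i\<in>{1..length w}. letter w i = a \<and> letter w (i - 1) = letter w i \<and>
      letter w i > letter w (i + 1)) \<longleftrightarrow> plat_at w a \<and> des_at w a"
    unfolding types ex at using inner outer by auto
  show "(\<exists>i\<in>{1..length w}. \<exists>j\<in>{1..length w}. i < j \<and> letter w i = a \<and> letter w j = a \<and>
      letter w (i - 1) < letter w i \<and> letter w j > letter w (j + 1)) \<longleftrightarrow>
      asc_at w a \<and> des_at w a"
    unfolding types ex2 at ..
  show "(\<exists>i\<in>{1..length w}. letter w i = a \<and> letter w (i - 1) < letter w i \<and>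
      letter w i = letter w (i + 1) \<and> letter w (i + 1) > letter w (i + 2)) \<longleftrightarrow>
      asc_at w a \<and> plat_at w a \<and> des_at w a"
    unfolding types ex at using inner outer adj by auto
  show "(\<exists>i\<in>{1..length w}. \<exists>j\<in>{1..length w}. i < j \<and> letter w i = a \<and> letter w j = a \<and>
      letter w (i - 1) > letter w i \<and> letter w i < letter w (i + 1) \<and>
      letter w (j - 1) > letter w j \<and> letter w j < letter w (j + 1)) \<longleftrightarrow>
      \<not> asc_at w a \<and> \<not> plat_at w a \<and> \<not> des_at w a"
    unfolding types ex2 at using inner outer by (auto simp: not_less)
qed

section \<open>Stirling words on arbitrary label sets\<close>

text \<open>Subtrees carry arbitrary label sets, hence the parameter \<open>L\<close>. Phrased
  through the pattern \<open>[a, b, a]\<close>, the Stirling condition passes to every subsequence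
  by transitivity.\<close>

definition stirling_words :: "nat set \<Rightarrow> nat list set" where
  "stirling_words L = {w. mset w = mset_set L + mset_set L \<and> (\<forall>a b. subseq [a, b, a] w \<longrightarrow> a < b)}"

lemma subseq3_conv_nth:
  "subseq [a, b, c] w \<longleftrightarrow>
     (\<exists>i j k. i < j \<and> j < k \<and> k < length w \<and> w ! i = a \<and> w ! j = b \<and> w ! k = c)"
proof
  assume "subseq [a, b, c] w"
  then obtain u v x y where "w = u @ a # v @ b # x @ c # y"
    by (auto dest!: list_emb_ConsD)
  then show "\<exists>i j k. i < j \<and> j < k \<and> k < length w \<and> w ! i = a \<and> w ! j = b \<and> w ! k = c"
    by (intro exI[of _ "length u"] exI[of _ "Suc (length u + length v)"]
        exI[of _ "Suc (Suc (length u + length v + length x))"]) (simp add: nth_append)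
next
  assume "\<exists>i j k. i < j \<and> j < k \<and> k < length w \<and> w ! i = a \<and> w ! j = b \<and> w ! k = c"
  then obtain i j k where *: "i < j" "j < k" "k < length w" "w ! i = a" "w ! j = b" "w ! k = c"
    by blast
  \<comment> \<open>The pattern is built from its last letter backwards: dropping fewer letters
    leaves a longer suffix, and \<open>step\<close> prepends the letter at its front.\<close>
  have mono: "subseq zs (drop m w)" if "subseq zs (drop l w)" "m \<le> l" for zs l m
  proof -
    have "suffix (drop l w) (drop m w)"
      using that(2) suffix_drop[of "l - m" "drop m w"] by simp
    then show ?thesis using that(1) subseq_order.trans by blast
  qed
  have step: "subseq (w ! l # zs) (drop l w)" if "subseq zs (drop (Suc l) w)" "l < length w" for zs l
    using that by (simp flip: Cons_nth_drop_Suc)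
  have len: "i < length w" "j < length w" "Suc i \<le> j" "Suc j \<le> k"
    using *(1-3) by simp_all
  have "subseq [c] (drop k w)"
    unfolding *(6)[symmetric] by (rule step[OF _ *(3)]) simp
  from step[OF mono[OF this len(4)] len(2)] have "subseq [b, c] (drop j w)"
    unfolding *(5) .
  from step[OF mono[OF this len(3)] len(1)] have "subseq [a, b, c] (drop i w)"
    unfolding *(4) .
  from mono[OF this, of 0] show "subseq [a, b, c] w" by simp
qed

lemma stirling_perms_eq: "stirling_perms n = stirling_words {1..n}"
proof -
  have eq: "(\<forall>i\<in>{1..2*n}. \<forall>j\<in>{1..2*n}. i < j \<and> letter w i = letter w j \<longrightarrow>
            (\<forall>k. i < k \<and> k < j \<longrightarrow> letter w k > letter w i)) \<longleftrightarrow>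
        (\<forall>a b. subseq [a, b, a] w \<longrightarrow> a < b)"
    if "mset w = mset_set {1..n} + mset_set {1..n}" for w
  proof -
    have len: "length w = 2 * n"
      using arg_cong[OF that, of size] by simp
    show ?thesis
    proof (intro iffI allI impI ballI)
      fix a b
      assume H: "\<forall>i\<in>{1..2*n}. \<forall>j\<in>{1..2*n}. i < j \<and> letter w i = letter w j \<longrightarrow>
            (\<forall>k. i < k \<and> k < j \<longrightarrow> letter w k > letter w i)" and "subseq [a, b, a] w"
      then obtain i j k where "i < j" "j < k" "k < 2 * n" "w ! i = a" "w ! j = b" "w ! k = a"
        unfolding subseq3_conv_nth len by blast
      \<comment> \<open>List indices start at 0 and \<open>letter\<close> at 1, hence the
        successors; the middle position \<open>j\<close> of the pattern instantiates the innermost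
        quantifier.\<close>
      with H[rule_format, of "Suc i" "Suc k" "Suc j"] show "a < b"
        by (simp add: letter_def len)
    next
      fix i j k
      assume H: "\<forall>a b. subseq [a, b, a] w \<longrightarrow> a < b"
        and ijk: "i \<in> {1..2*n}" "j \<in> {1..2*n}" "i < j \<and> letter w i = letter w j" "i < k \<and> k < j"
      from ijk have "1 \<le> i" "i < k" "k < j" "j \<le> length w" "letter w i = letter w j"
        by (simp_all add: len)
      then have "i - 1 < k - 1" "k - 1 < j - 1" "j - 1 < length w"
        "w ! (i - 1) = letter w i" "w ! (k - 1) = letter w k" "w ! (j - 1) = letter w i"
        by (simp_all add: letter_def)
      then have "subseq [letter w i, letter w k, letter w i] w"
        unfolding subseq3_conv_nth by blast
      with H show "letter w i < letter w k" by blast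
    qed
  qed
  show ?thesis
    unfolding stirling_perms_def stirling_words_def
    by (rule Collect_cong, rule conj_cong[OF refl], rule eq)
qed

lemma stirling_wordD:
  assumes "w \<in> stirling_words L"
  shows "mset w = mset_set L + mset_set L"
    and "subseq [a, b, a] w \<Longrightarrow> a < b"
    and "finite L \<Longrightarrow> set w = L"
proof -
  show mset: "mset w = mset_set L + mset_set L" and "subseq [a, b, a] w \<Longrightarrow> a < b"
    using assms unfolding stirling_words_def by blast+
  show "set w = L" if "finite L"
    using arg_cong[OF mset, of set_mset] that by simp
qed

lemma finite_stirling_words: "finite (stirling_words L)"
proof -
  obtain u where "mset u = mset_set L + mset_set L"
    using ex_mset by blast
  then have "stirling_words L \<subseteq> {w. mset w = mset u}"
    by (auto simp: stirling_words_def)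
  then show ?thesis
    using mset_eq_finite finite_subset by blast
qed

lemma stirling_words_empty: "stirling_words {} = {[]}"
  by (auto simp: stirling_words_def)

text \<open>Cutting at the first two occurrences of \<open>a\<close> leaves none in
  \<open>x\<close>, since its multiplicity is 2. Each letter \<open>b\<close> between them completes
  a pattern \<open>[a, b, a]\<close> and so exceeds \<open>a\<close>.\<close>

lemma stirling_word_split:
  assumes w: "w \<in> stirling_words L" and L: "finite L" "0 \<notin> L" and a: "a \<in> L"
  obtains u v x where "w = u @ a # v @ a # x" "split_at a u v x"
proof -
  have c: "count (mset w) a = 2" using w L a by (simp add: stirling_words_def)
  then have "a \<in> set w" using count_greater_zero_iff[of "mset w" a] by simp
  then obtain u y where y: "w = u @ a # y" "a \<notin> set u" by (meson split_list_first)
  have cy: "count (mset y) a = 1" using c y by (simp flip: count_mset_0_iff)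
  then have "a \<in> set y" using count_greater_zero_iff[of "mset y" a] by simp
  then obtain v x where x: "y = v @ a # x" "a \<notin> set v" by (meson split_list_first)
  have "count (mset x) a = 0" using cy x by (simp flip: count_mset_0_iff)
  then have ax: "a \<notin> set x" by (simp add: count_eq_zero_iff)
  have "a < b" if "b \<in> set v" for b
  proof -
    have "subseq ([] @ [a] @ [b] @ [a] @ []) (u @ [a] @ v @ [a] @ x)"
      using that by (intro list_emb_append_mono) (auto simp: subseq_singleton_left)
    then show ?thesis using w by (simp add: stirling_words_def y x)
  qed
  moreover have "0 < a" using a L by (cases a) auto
  ultimately show thesis using that y x ax by (auto simp: split_at_def)
qed

lemma set_subseq: "subseq xs ys \<Longrightarrow> set xs \<subseteq> set ys"
  by (auto elim: list_emb_set)

text \<open>A nonempty part of the pattern matched inside \<open>y\<close> would end in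
  \<open>a\<close>. Together with the mirror image for prefixes, this confines a pattern
  \<open>[a, b, a]\<close> to the only block that contains \<open>a\<close>.\<close>

lemma subseq_snocD_notin:
  assumes "subseq (zs @ [a]) (u @ y)" and "a \<notin> set y"
  shows "subseq (zs @ [a]) u"
proof -
  from assms(1) obtain xs ys where xy: "zs @ [a] = xs @ ys" "subseq xs u" "subseq ys y"
    unfolding subseq_append_iff by blast
  have "ys = []"
  proof (rule ccontr)
    assume "ys \<noteq> []"
    then have "a = last ys" using arg_cong[OF xy(1), of last] by simp
    then have "a \<in> set ys" using \<open>ys \<noteq> []\<close> by simp
    then show False using set_subseq[OF xy(3)] assms(2) by blast
  qed
  then show ?thesis using xy by simp
qed

lemma subseq_ConsD_notin:
  assumes "subseq (a # zs) (y @ u)" and "a \<notin> set y"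
  shows "subseq (a # zs) u"
  using assms by (induction y) auto

text \<open>A pattern \<open>[a, b, a]\<close> with \<open>a\<close> different from \<open>m\<close>
  lies within one block, because the blocks have disjoint labels. For \<open>a = m\<close> the
  middle letter is larger, as \<open>m\<close> is below all other labels and has only two
  copies.\<close>

lemma stirling_word_join:
  assumes SW: "u \<in> stirling_words A" "v \<in> stirling_words B" "x \<in> stirling_words C"
    and fin: "finite A" "finite B" "finite C"
    and dis: "A \<inter> B = {}" "A \<inter> C = {}" "B \<inter> C = {}"
    and m: "\<And>b. b \<in> A \<union> B \<union> C \<Longrightarrow> m < b"
  shows "u @ m # v @ m # x \<in> stirling_words (insert m (A \<union> B \<union> C))"
proof -
  have set: "set u = A" "set v = B" "set x = C"
    using SW fin by (auto simp: stirling_wordD(3))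
  have nin: "m \<notin> A" "m \<notin> B" "m \<notin> C" using m by auto
  have dis': "(A \<union> B) \<inter> C = {}" using dis by blast
  have "mset_set (insert m (A \<union> B \<union> C)) = add_mset m (mset_set A + mset_set B + mset_set C)"
    using fin nin dis dis' by (simp add: mset_set_Union)
  then have "mset (u @ m # v @ m # x) =
      mset_set (insert m (A \<union> B \<union> C)) + mset_set (insert m (A \<union> B \<union> C))"
    using SW[THEN stirling_wordD(1)] by simp
  moreover have "a < b" if sub: "subseq [a, b, a] (u @ m # v @ m # x)" for a b
  proof -
    have "set [a, b, a] \<subseteq> set (u @ m # v @ m # x)"
      using sub by (rule set_subseq)
    then have ab: "a \<in> insert m (A \<union> B \<union> C)" "b \<in> insert m (A \<union> B \<union> C)"
      using set by auto
    consider "a = m" | "a \<in> A" | "a \<in> B" | "a \<in> C" using ab by blast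
    then show ?thesis
    proof cases
      case 1
      have "b \<noteq> m"
      proof
        assume "b = m"
        \<comment> \<open>Keeping only the copies of \<open>m\<close> leaves three in the pattern
          but two in the word.\<close>
        then have "subseq (filter ((=) m) [m, m, m]) (filter ((=) m) (u @ m # v @ m # x))"
          using sub 1 subseq_filter by blast
        moreover have "filter ((=) m) u = []" "filter ((=) m) v = []" "filter ((=) m) x = []"
          using nin set by (auto simp: filter_empty_conv)
        ultimately show False by simp
      qed
      then show ?thesis using 1 ab m by blast
    next
      case 2
      then have "a \<notin> set (m # v @ m # x)" using nin dis set by auto
      then have "subseq [a, b, a] u"
        using subseq_snocD_notin[of "[a, b]" a u] sub by simp
      then show ?thesis using SW stirling_wordD(2) by blast
    next
      case 3
      then have a: "a \<notin> set (u @ [m])" "a \<notin> set (m # x)" using nin dis set by auto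
      have "subseq [a, b, a] ((u @ [m]) @ v @ m # x)" using sub by simp
      then have "subseq [a, b, a] (v @ m # x)"
        by (rule subseq_ConsD_notin) (rule a)
      then have "subseq [a, b, a] v"
        using subseq_snocD_notin[of "[a, b]" a v] a by simp
      then show ?thesis using SW stirling_wordD(2) by blast
    next
      case 4
      then have a: "a \<notin> set (u @ m # v @ [m])" using nin dis set by auto
      have "subseq [a, b, a] ((u @ m # v @ [m]) @ x)" using sub by simp
      then have "subseq [a, b, a] x"
        by (rule subseq_ConsD_notin) (rule a)
      then show ?thesis using SW stirling_wordD(2) by blast
    qed
  qed
  ultimately show ?thesis unfolding stirling_words_def by blast
qed

text \<open>A letter \<open>a\<close> occurring in two of the blocks would surround a copy of
  \<open>m\<close>, and the pattern \<open>[a, m, a]\<close> contradicts the minimality of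
  \<open>m\<close>. So both copies of each other letter lie in the same block.\<close>

lemma stirling_word_decompose:
  assumes w: "w \<in> stirling_words L" and L: "finite L" "0 \<notin> L" and m: "m \<in> L" "\<And>b. b \<in> L \<Longrightarrow> m \<le> b"
  obtains u v x where "w = u @ m # v @ m # x"
    and "u \<in> stirling_words (set u)" "v \<in> stirling_words (set v)" "x \<in> stirling_words (set x)"
    and "set u \<inter> set v = {}" "set u \<inter> set x = {}" "set v \<inter> set x = {}"
    and "set u \<union> set v \<union> set x = L - {m}"
proof -
  obtain u v x where eq: "w = u @ m # v @ m # x" and sp: "split_at m u v x"
    using stirling_word_split[OF w L m(1)] .
  have setw: "set w = L" using w L(1) by (rule stirling_wordD(3))
  have nin: "m \<notin> set u" "m \<notin> set v" "m \<notin> set x" using sp by (auto simp: split_at_def)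
  have av: "a < b" if "subseq [a, b, a] w" for a b
    using w that by (simp add: stirling_words_def)
  have no: "\<not> subseq [a, m, a] w" if "a \<in> L" for a
    using av[of a m] m(2)[OF that] by auto
  have uv: "set u \<inter> set v = {}"
  proof (rule ccontr)
    assume "set u \<inter> set v \<noteq> {}"
    then obtain a where a: "a \<in> set u" "a \<in> set v" by blast
    then have "subseq ([a] @ [m] @ [a]) (u @ [m] @ v @ m # x)"
      by (intro list_emb_append_mono subseq_rev_drop_many) (auto simp: subseq_singleton_left)
    then show False using no[of a] a setw eq by auto
  qed
  have vx: "set v \<inter> set x = {}"
  proof (rule ccontr)
    assume "set v \<inter> set x \<noteq> {}"
    then obtain a where a: "a \<in> set v" "a \<in> set x" by blast
    then have "subseq ([a] @ [m] @ [a]) ((u @ m # v) @ [m] @ x)"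
      by (intro list_emb_append_mono) (auto simp: subseq_singleton_left)
    then show False using no[of a] a setw eq by auto
  qed
  have ux: "set u \<inter> set x = {}"
  proof (rule ccontr)
    assume "set u \<inter> set x \<noteq> {}"
    then obtain a where a: "a \<in> set u" "a \<in> set x" by blast
    then have "subseq ([a] @ [m] @ [a]) (u @ [m] @ (v @ m # x))"
      by (intro list_emb_append_mono) (auto simp: subseq_singleton_left)
    then show False using no[of a] a setw eq by auto
  qed
  have cnt: "count (mset u) a + count (mset v) a + count (mset x) a = 2" if "a \<in> L" "a \<noteq> m" for a
  proof -
    have "count (mset w) a = 2" using w L(1) that by (simp add: stirling_words_def)
    then show ?thesis using that eq by simp
  qed
  have sub: "y \<in> stirling_words (set y)"
    if y: "\<And>a. a \<in> set y \<Longrightarrow> count (mset y) a = 2" and "subseq y w" for y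
  proof -
    have "mset y = mset_set (set y) + mset_set (set y)"
    proof (rule multiset_eqI)
      fix a
      show "count (mset y) a = count (mset_set (set y) + mset_set (set y)) a"
      proof (cases "a \<in> set y")
        case False
        then have "count (mset y) a = 0" by simp
        then show ?thesis using False by simp
      qed (simp add: y)
    qed
    then show ?thesis
      using av[OF subseq_order.trans[OF _ \<open>subseq y w\<close>]] unfolding stirling_words_def by blast
  qed
  have "u \<in> stirling_words (set u)"
  proof (rule sub)
    fix a assume a: "a \<in> set u"
    then have "count (mset v) a = 0" "count (mset x) a = 0" using uv ux by auto
    moreover have "a \<in> L" "a \<noteq> m" using a nin setw eq by auto
    ultimately show "count (mset u) a = 2" using cnt[of a] by linarith
  qed (simp add: eq subseq_rev_drop_many)
  moreover have "v \<in> stirling_words (set v)"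
  proof (rule sub)
    fix a assume a: "a \<in> set v"
    then have "count (mset u) a = 0" "count (mset x) a = 0" using uv vx by auto
    moreover have "a \<in> L" "a \<noteq> m" using a nin setw eq by auto
    ultimately show "count (mset v) a = 2" using cnt[of a] by linarith
  qed (simp add: eq subseq_drop_many subseq_rev_drop_many list_emb_Cons)
  moreover have "x \<in> stirling_words (set x)"
  proof (rule sub)
    fix a assume a: "a \<in> set x"
    then have "count (mset u) a = 0" "count (mset v) a = 0" using ux vx by auto
    moreover have "a \<in> L" "a \<noteq> m" using a nin setw eq by auto
    ultimately show "count (mset x) a = 2" using cnt[of a] by linarith
  qed (simp add: eq subseq_drop_many list_emb_Cons)
  moreover have "set u \<union> set v \<union> set x = L - {m}" using setw eq nin by auto
  ultimately show thesis using that eq uv ux vx by blast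
qed

section \<open>The recursion at the least letter\<close>

text \<open>Triples are ordered and may have empty entries: they are the label sets of the three
  subtrees of a root.\<close>

definition tripartitions :: "'b set \<Rightarrow> ('b set \<times> 'b set \<times> 'b set) set" where
  "tripartitions K = {(A, B, C). A \<union> B \<union> C = K \<and> A \<inter> B = {} \<and> A \<inter> C = {} \<and> B \<inter> C = {}}"

text \<open>The cuts can be recovered from the word as its first two occurrences of
  \<open>m\<close>.\<close>

lemma inj_on_join:
  "inj_on (\<lambda>(u, v, x). u @ m # v @ m # x)
     {(u, v, x). m \<notin> set u \<and> m \<notin> set v \<and> m \<notin> set x}"
proof -
  have main: "u = u' \<and> v = v' \<and> x = x'"
    if "u @ m # v @ m # x = u' @ m # v' @ m # x'" "m \<notin> set u" "m \<notin> set v" "m \<notin> set u'" "m \<notin> set v'"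
    for u v x u' v' x'
  proof -
    have *: "u = u' \<and> y = y'" if "u @ m # y = u' @ m # y'" "m \<notin> set u" "m \<notin> set u'" for u u' y y'
      using that
    proof (induction u arbitrary: u')
      case Nil
      then show ?case by (cases u') auto
    next
      case (Cons c u)
      then show ?case by (cases u') auto
    qed
    show ?thesis using *[OF that(1,2,4)] *[of v x v' x'] that by blast
  qed
  show ?thesis
  proof (rule inj_onI)
    fix p q :: "'a list \<times> 'a list \<times> 'a list"
    assume *: "p \<in> {(u, v, x). m \<notin> set u \<and> m \<notin> set v \<and> m \<notin> set x}"
      "q \<in> {(u, v, x). m \<notin> set u \<and> m \<notin> set v \<and> m \<notin> set x}"
      "(\<lambda>(u, v, x). u @ m # v @ m # x) p = (\<lambda>(u, v, x). u @ m # v @ m # x) q"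
    obtain u v x u' v' x' where "p = (u, v, x)" "q = (u', v', x')"
      using prod_cases3[of p] prod_cases3[of q] by metis
    then show "p = q" using * main[of u v x u' v' x'] by simp
  qed
qed

lemma stirling_words_recursion:
  assumes L: "finite L" "0 \<notin> L" and m: "m \<in> L" "\<And>b. b \<in> L \<Longrightarrow> m \<le> b"
  shows "stirling_words L = (\<lambda>(u, v, x). u @ m # v @ m # x) `
    (\<Union>(A, B, C)\<in>tripartitions (L - {m}). stirling_words A \<times> stirling_words B \<times> stirling_words C)"
    (is "_ = ?f ` ?U")
proof (intro equalityI subsetI)
  fix w assume "w \<in> stirling_words L"
  then obtain u v x where "w = u @ m # v @ m # x"
    and "u \<in> stirling_words (set u)" "v \<in> stirling_words (set v)" "x \<in> stirling_words (set x)"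
    and "set u \<inter> set v = {}" "set u \<inter> set x = {}" "set v \<inter> set x = {}"
    and "set u \<union> set v \<union> set x = L - {m}"
    by (rule stirling_word_decompose[OF _ L m])
  then show "w \<in> ?f ` ?U"
    by (intro image_eqI[of _ _ "(u, v, x)"] UN_I[of "(set u, set v, set x)"])
      (auto simp: tripartitions_def)
next
  fix w assume "w \<in> ?f ` ?U"
  then obtain A B C u v x where *: "(A, B, C) \<in> tripartitions (L - {m})" "w = u @ m # v @ m # x"
    "u \<in> stirling_words A" "v \<in> stirling_words B" "x \<in> stirling_words C" by auto
  then have un: "A \<union> B \<union> C = L - {m}" and dis: "A \<inter> B = {}" "A \<inter> C = {}" "B \<inter> C = {}"
    by (auto simp: tripartitions_def)
  have "finite (A \<union> B \<union> C)" using un L by simp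
  moreover have "m < b" if "b \<in> A \<union> B \<union> C" for b
    using that m(2)[of b] unfolding un by auto
  ultimately have "u @ m # v @ m # x \<in> stirling_words (insert m (A \<union> B \<union> C))"
    using * dis by (intro stirling_word_join) auto
  then show "w \<in> stirling_words L" using un m(1) * by (simp add: insert_absorb)
qed

section \<open>Multiplicative weights and their generating function\<close>

definition word_weight :: "(bool \<Rightarrow> bool \<Rightarrow> bool \<Rightarrow> 'a::comm_monoid_mult) \<Rightarrow> nat list \<Rightarrow> 'a" where
  "word_weight \<phi> w = (\<Prod>a\<in>set w. \<phi> (asc_at w a) (plat_at w a) (des_at w a))"

text \<open>The context can change an outer neighbour of \<open>a\<close> only when that neighbour
  was the padding 0. Its replacement is again smaller than \<open>a\<close>, so no comparison
  changes.\<close>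

lemma types_in_context:
  assumes w: "w \<in> stirling_words A" and A: "finite A" "0 \<notin> A" "a \<in> A"
    and y: "a \<notin> set y" "y \<noteq> [] \<Longrightarrow> last y < a" and z: "a \<notin> set z" "z \<noteq> [] \<Longrightarrow> hd z < a"
  shows "asc_at (y @ w @ z) a \<longleftrightarrow> asc_at w a"
    and "plat_at (y @ w @ z) a \<longleftrightarrow> plat_at w a"
    and "des_at (y @ w @ z) a \<longleftrightarrow> des_at w a"
proof -
  obtain u v x where eq: "w = u @ a # v @ a # x" and sp: "split_at a u v x"
    using stirling_word_split[OF w A] .
  have eq': "y @ w @ z = (y @ u) @ a # v @ a # (x @ z)" by (simp add: eq)
  have sp': "split_at a (y @ u) v (x @ z)" using sp y z by (simp add: split_at_def)
  have "0 < a" using sp by (simp add: split_at_def)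
  then show "asc_at (y @ w @ z) a \<longleftrightarrow> asc_at w a"
    using y types_split(1)[OF sp eq] types_split(1)[OF sp' eq'] by (auto split: if_splits)
  show "plat_at (y @ w @ z) a \<longleftrightarrow> plat_at w a"
    using types_split(2)[OF sp eq] types_split(2)[OF sp' eq'] by simp
  show "des_at (y @ w @ z) a \<longleftrightarrow> des_at w a"
    using z \<open>0 < a\<close> types_split(3)[OF sp eq] types_split(3)[OF sp' eq']
    by (auto simp: hd_append split: if_splits)
qed

text \<open>Every other letter exceeds \<open>m\<close>, so an outer neighbour of \<open>m\<close>
  is smaller only if it is padding, that is, if the block there is empty. Each block is in turn
  bordered by \<open>m\<close> or the padding, both below its letters, which therefore keep their
  types.\<close>

lemma word_weight_join:
  assumes SW: "u \<in> stirling_words A" "v \<in> stirling_words B" "x \<in> stirling_words C"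
    and fin: "finite A" "finite B" "finite C"
    and dis: "A \<inter> B = {}" "A \<inter> C = {}" "B \<inter> C = {}"
    and m: "\<And>b. b \<in> A \<union> B \<union> C \<Longrightarrow> m < b" "0 < m"
  shows "word_weight \<phi> (u @ m # v @ m # x) =
    \<phi> (A = {}) (B = {}) (C = {}) * (word_weight \<phi> u * word_weight \<phi> v * word_weight \<phi> x)"
proof -
  define w where "w = u @ m # v @ m # x"
  define t where "t w' a = \<phi> (asc_at w' a) (plat_at w' a) (des_at w' a)" for w' a
  have set: "set u = A" "set v = B" "set x = C"
    using SW fin by (auto simp: stirling_wordD(3))
  have nin: "m \<notin> A" "m \<notin> B" "m \<notin> C" and zero: "0 \<notin> A" "0 \<notin> B" "0 \<notin> C"
    using m(1)[of m] m(1)[of 0] by auto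
  have emp: "u = [] \<longleftrightarrow> A = {}" "v = [] \<longleftrightarrow> B = {}" "x = [] \<longleftrightarrow> C = {}"
    using set by auto
  have "t w m = \<phi> (A = {}) (B = {}) (C = {})"
  proof -
    have sp: "split_at m u v x" using nin m set by (auto simp: split_at_def)
    have "last (0 # u) < m \<longleftrightarrow> u = []"
      using m set last_in_set[of u] by (auto dest: less_asym)
    moreover have "hd (x @ [0]) < m \<longleftrightarrow> x = []"
      using m set hd_in_set[of x] by (cases x) (auto dest: less_asym)
    ultimately show ?thesis
      by (simp add: t_def emp types_split(1)[OF sp w_def] types_split(2)[OF sp w_def]
          types_split(3)[OF sp w_def] del: last.simps)
  qed
  moreover have "t w a = t u a" if a: "a \<in> A" for a
  proof -
    have "a \<noteq> m" "a \<notin> B" "a \<notin> C" "m < a" using a nin dis m(1)[of a] by auto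
    then show ?thesis
      using types_in_context[OF SW(1) fin(1) zero(1) a, of "[]" "m # v @ m # x"] set
      by (simp add: t_def w_def)
  qed
  moreover have "t w a = t v a" if a: "a \<in> B" for a
  proof -
    have "a \<noteq> m" "a \<notin> A" "a \<notin> C" "m < a" using a nin dis m(1)[of a] by auto
    then show ?thesis
      using types_in_context[OF SW(2) fin(2) zero(2) a, of "u @ [m]" "m # x"] set
      by (simp add: t_def w_def)
  qed
  moreover have "t w a = t x a" if a: "a \<in> C" for a
  proof -
    have "a \<noteq> m" "a \<notin> A" "a \<notin> B" "m < a" using a nin dis m(1)[of a] by auto
    then show ?thesis
      using types_in_context[OF SW(3) fin(3) zero(3) a, of "u @ m # v @ [m]" "[]"] set
      by (simp add: t_def w_def)
  qed
  moreover have "word_weight \<phi> w = t w m * (prod (t w) A * prod (t w) B * prod (t w) C)"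
  proof -
    have "set w = insert m (A \<union> B \<union> C)" using set by (auto simp: w_def)
    moreover have "(A \<union> B) \<inter> C = {}" using dis by blast
    ultimately show ?thesis using nin fin dis
      by (simp add: word_weight_def t_def prod.union_disjoint)
  qed
  ultimately show ?thesis
    using set by (simp add: word_weight_def flip: t_def w_def)
qed

definition total_weight :: "(bool \<Rightarrow> bool \<Rightarrow> bool \<Rightarrow> 'a::comm_semiring_1) \<Rightarrow> nat set \<Rightarrow> 'a" where
  "total_weight \<phi> L = (\<Sum>w\<in>stirling_words L. word_weight \<phi> w)"

text \<open>The factor of the root depends only on which label sets are empty. It is constant for a
  fixed tripartition, where the remaining sum factors over the three subtrees.\<close>

lemma total_weight_recursion:
  assumes L: "finite L" "0 \<notin> L" and m: "m \<in> L" "\<And>b. b \<in> L \<Longrightarrow> m \<le> b"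
  shows "total_weight \<phi> L = (\<Sum>(A, B, C)\<in>tripartitions (L - {m}).
    \<phi> (A = {}) (B = {}) (C = {}) * (total_weight \<phi> A * total_weight \<phi> B * total_weight \<phi> C))"
proof -
  let ?f = "\<lambda>(u, v, x). u @ m # v @ m # x"
  let ?S = "\<lambda>(A, B, C). stirling_words A \<times> stirling_words B \<times> stirling_words C"
  have tri: "finite A" "finite B" "finite C" "A \<inter> B = {}" "A \<inter> C = {}" "B \<inter> C = {}"
    "b \<in> A \<union> B \<union> C \<Longrightarrow> m < b" if "(A, B, C) \<in> tripartitions (L - {m})" for A B C b
  proof -
    have un: "A \<union> B \<union> C = L - {m}" using that by (auto simp: tripartitions_def)
    have "finite (A \<union> B \<union> C)" using un L by simp
    then show "finite A" "finite B" "finite C" by auto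
    show "A \<inter> B = {}" "A \<inter> C = {}" "B \<inter> C = {}" using that by (auto simp: tripartitions_def)
    show "m < b" if "b \<in> A \<union> B \<union> C" using that m(2)[of b] unfolding un by auto
  qed
  \<comment> \<open>A triple of words determines its tripartition, so the products over different
    tripartitions are disjoint.\<close>
  have sets: "set u = A" "set v = B" "set x = C"
    if "(A, B, C) \<in> tripartitions (L - {m})" "(u, v, x) \<in> ?S (A, B, C)" for A B C u v x
    using that tri[OF that(1)] by (auto simp: stirling_wordD(3))
  have inj: "inj_on ?f (\<Union>T\<in>tripartitions (L - {m}). ?S T)"
  proof (rule inj_on_subset[OF inj_on_join], clarify)
    fix A B C u v x
    assume *: "(A, B, C) \<in> tripartitions (L - {m})"
      "u \<in> stirling_words A" "v \<in> stirling_words B" "x \<in> stirling_words C"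
    then show "m \<notin> set u \<and> m \<notin> set v \<and> m \<notin> set x"
      using sets[of A B C u v x] tri(7)[OF *(1), of m] by auto
  qed
  have "total_weight \<phi> L = (\<Sum>t\<in>(\<Union>T\<in>tripartitions (L - {m}). ?S T). word_weight \<phi> (?f t))"
    unfolding total_weight_def using arg_cong[OF stirling_words_recursion[OF L m], of "sum (word_weight \<phi>)"]
    unfolding sum.reindex[OF inj] o_def .
  also have "\<dots> = (\<Sum>T\<in>tripartitions (L - {m}). \<Sum>t\<in>?S T. word_weight \<phi> (?f t))"
  proof (rule sum.UNION_disjoint)
    show "\<forall>T\<in>tripartitions (L - {m}). \<forall>T'\<in>tripartitions (L - {m}). T \<noteq> T' \<longrightarrow> ?S T \<inter> ?S T' = {}"
    proof (intro ballI impI, rule ccontr)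
      fix T T' assume T: "T \<in> tripartitions (L - {m})" "T' \<in> tripartitions (L - {m})" "T \<noteq> T'"
        and "?S T \<inter> ?S T' \<noteq> {}"
      then obtain t where t: "t \<in> ?S T" "t \<in> ?S T'" by blast
      obtain A B C A' B' C' u v x where "T = (A, B, C)" "T' = (A', B', C')" "t = (u, v, x)"
        by (metis prod_cases3)
      then show False using T t sets[of A B C u v x] sets[of A' B' C' u v x] by simp
    qed
  next
    show "finite (tripartitions (L - {m}))"
      by (rule finite_subset[of _ "Pow L \<times> Pow L \<times> Pow L"]) (use L in \<open>auto simp: tripartitions_def\<close>)
  qed (auto simp: finite_stirling_words)
  also have "\<dots> = (\<Sum>(A, B, C)\<in>tripartitions (L - {m}).
    \<phi> (A = {}) (B = {}) (C = {}) * (total_weight \<phi> A * total_weight \<phi> B * total_weight \<phi> C))"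
  proof (rule sum.cong[OF refl], clarify)
    fix A B C assume T: "(A, B, C) \<in> tripartitions (L - {m})"
    have "0 < m" using L m by (cases m) auto
    then have "word_weight \<phi> (u @ m # v @ m # x) =
        \<phi> (A = {}) (B = {}) (C = {}) * (word_weight \<phi> u * word_weight \<phi> v * word_weight \<phi> x)"
      if "u \<in> stirling_words A" "v \<in> stirling_words B" "x \<in> stirling_words C" for u v x
      using word_weight_join[OF that] tri[OF T] by blast
    then have "(\<Sum>t\<in>stirling_words A \<times> stirling_words B \<times> stirling_words C. word_weight \<phi> (?f t)) =
      (\<Sum>(u, v, x)\<in>stirling_words A \<times> stirling_words B \<times> stirling_words C.
        \<phi> (A = {}) (B = {}) (C = {}) * (word_weight \<phi> u * word_weight \<phi> v * word_weight \<phi> x))"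
      by (intro sum.cong) auto
    also have "\<dots> = \<phi> (A = {}) (B = {}) (C = {}) *
        (total_weight \<phi> A * total_weight \<phi> B * total_weight \<phi> C)"
      unfolding total_weight_def
      by (simp add: mult.assoc flip: sum.cartesian_product sum_distrib_left sum_distrib_right)
    finally show "(\<Sum>t\<in>stirling_words A \<times> stirling_words B \<times> stirling_words C. word_weight \<phi> (?f t)) =
      \<phi> (A = {}) (B = {}) (C = {}) * (total_weight \<phi> A * total_weight \<phi> B * total_weight \<phi> C)" .
  qed
  finally show ?thesis .
qed

section \<open>Rotating the subtrees\<close>

lemma sum_tripartitions_rotate:
  "(\<Sum>(A, B, C)\<in>tripartitions K. f A B C) = (\<Sum>(A, B, C)\<in>tripartitions K. f B C A)"
  by (rule sum.reindex_bij_witness[of _ "\<lambda>(A, B, C). (B, C, A)" "\<lambda>(A, B, C). (C, A, B)"])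
    (auto simp: tripartitions_def)

text \<open>By strong induction on the label set. The product of the subtree sums is symmetric, so
  rotating the tripartition moves the rotation onto the root factor alone; adding the three
  rotations leaves only its cyclic sum, and 3 can be cancelled in characteristic 0.\<close>

lemma total_weight_cong_cyclic:
  fixes \<phi> \<psi> :: "bool \<Rightarrow> bool \<Rightarrow> bool \<Rightarrow> 'a::field_char_0"
  assumes cyc: "\<And>a b c. \<phi> a b c + \<phi> b c a + \<phi> c a b = \<psi> a b c + \<psi> b c a + \<psi> c a b"
    and "finite L" and "0 \<notin> L"
  shows "total_weight \<phi> L = total_weight \<psi> L"
  using assms(2,3)
proof (induction L rule: finite_psubset_induct)
  case (psubset L)
  show ?case
  proof (cases "L = {}")
    case False
    define m where "m = Min L"
    have m: "m \<in> L" "\<And>b. b \<in> L \<Longrightarrow> m \<le> b" using psubset(1) False by (auto simp: m_def)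
    \<comment> \<open>Formed with the second weight throughout: by the induction hypothesis both
      recursions have this same product, and differ only in the root factor.\<close>
    define G where "G A B C = total_weight \<psi> A * total_weight \<psi> B * total_weight \<psi> C" for A B C
    define S where "S \<chi> = (\<Sum>(A, B, C)\<in>tripartitions (L - {m}).
      \<chi> (A = {}) (B = {}) (C = {}) * G A B C)" for \<chi> :: "bool \<Rightarrow> bool \<Rightarrow> bool \<Rightarrow> 'a"
    have "total_weight \<phi> A * total_weight \<phi> B * total_weight \<phi> C = G A B C"
      if "(A, B, C) \<in> tripartitions (L - {m})" for A B C
    proof -
      have "A \<subset> L" "B \<subset> L" "C \<subset> L" using that m(1) by (auto simp: tripartitions_def)
      moreover from this have "0 \<notin> A" "0 \<notin> B" "0 \<notin> C" using psubset by auto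
      ultimately show ?thesis using psubset by (simp add: G_def)
    qed
    then have \<phi>: "total_weight \<phi> L = S \<phi>"
      by (subst total_weight_recursion[OF psubset(1,3) m]) (auto simp: S_def intro!: sum.cong)
    have \<psi>: "total_weight \<psi> L = S \<psi>"
      unfolding S_def G_def by (rule total_weight_recursion[OF psubset(1,3) m])
    have rot: "S \<chi> = S (\<lambda>a b c. \<chi> b c a)" for \<chi>
      unfolding S_def by (subst sum_tripartitions_rotate) (simp add: G_def mult_ac)
    have three: "3 * S \<chi> = S (\<lambda>a b c. \<chi> a b c + \<chi> b c a + \<chi> c a b)" for \<chi>
    proof -
      have "3 * S \<chi> = S \<chi> + S (\<lambda>a b c. \<chi> b c a) + S (\<lambda>a b c. \<chi> c a b)"
        using rot[of \<chi>] rot[of "\<lambda>a b c. \<chi> b c a"] by simp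
      also have "\<dots> = S (\<lambda>a b c. \<chi> a b c + \<chi> b c a + \<chi> c a b)"
        unfolding S_def by (simp add: sum.distrib case_prod_beta algebra_simps)
      finally show ?thesis .
    qed
    have "3 * S \<phi> = 3 * S \<psi>" unfolding three cyc ..
    then show ?thesis using \<phi> \<psi> by simp
  qed (simp add: total_weight_def stirling_words_empty word_weight_def)
qed

section \<open>The weight encoding the eight statistics\<close>

text \<open>
  The Boolean arguments of a weight say whether the node is an ascent, a plateau, a descent.
\<close>

definition node_weight ::
  "'a::comm_semiring_1 \<Rightarrow> 'a \<Rightarrow> 'a \<Rightarrow> 'a \<Rightarrow> 'a \<Rightarrow> 'a \<Rightarrow> 'a \<Rightarrow> 'a \<Rightarrow> bool \<Rightarrow> bool \<Rightarrow> bool \<Rightarrow> 'a" where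
  "node_weight x y z p q r s t a b c =
     (if a then x else 1) * (if b then y else 1) * (if c then z else 1) *
     (if a \<and> b then p else 1) * (if a \<and> c then q else 1) * (if b \<and> c then r else 1) *
     (if a \<and> b \<and> c then s else 1) * (if \<not> a \<and> \<not> b \<and> \<not> c then t else 1)"

text \<open>Each letter has a splitting, so \<open>types_split\<close> turns every statistic into
  the number of letters satisfying a Boolean condition on types, which is the exponent in the
  product over all letters.\<close>

lemma word_weight_node_weight:
  fixes x y z p q r s t :: "'a::comm_semiring_1"
  assumes "w \<in> stirling_words L" and "finite L" and "0 \<notin> L"
  shows "word_weight (node_weight x y z p q r s t) w =
    x ^ asc w * y ^ plat w * z ^ des w * p ^ lap w * q ^ eud w * r ^ rpd w * s ^ apd w * t ^ vv w"
proof -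
  have ex: "\<exists>u v x. split_at a u v x \<and> w = u @ a # v @ a # x" if "a \<in> set w" for a
    using stirling_word_split[OF assms(1) assms(2,3)] that stirling_wordD(3)[OF assms(1,2)] by metis
  have "asc w = card {a \<in> set w. asc_at w a}"
    by (simp add: asc_def asc_at_def)
  moreover have "plat w = card {a \<in> set w. plat_at w a}"
    by (simp add: plat_def plat_at_def)
  moreover have "des w = card {a \<in> set w. des_at w a}"
    by (simp add: des_def des_at_def)
  moreover have "lap w = card {a \<in> set w. asc_at w a \<and> plat_at w a}"
    unfolding lap_def
    by (intro arg_cong[of _ _ card] Collect_cong conj_cong refl, drule ex, elim exE conjE, erule (1) types_split(4))
  moreover have "eud w = card {a \<in> set w. asc_at w a \<and> des_at w a}"
    unfolding eud_def
    by (intro arg_cong[of _ _ card] Collect_cong conj_cong refl, drule ex, elim exE conjE, erule (1) types_split(6))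
  moreover have "rpd w = card {a \<in> set w. plat_at w a \<and> des_at w a}"
    unfolding rpd_def
    by (intro arg_cong[of _ _ card] Collect_cong conj_cong refl, drule ex, elim exE conjE, erule (1) types_split(5))
  moreover have "apd w = card {a \<in> set w. asc_at w a \<and> plat_at w a \<and> des_at w a}"
    unfolding apd_def
    by (intro arg_cong[of _ _ card] Collect_cong conj_cong refl, drule ex, elim exE conjE, erule (1) types_split(7))
  moreover have "vv w = card {a \<in> set w. \<not> asc_at w a \<and> \<not> plat_at w a \<and> \<not> des_at w a}"
    unfolding vv_def
    by (intro arg_cong[of _ _ card] Collect_cong conj_cong refl, drule ex, elim exE conjE, erule (1) types_split(8))
  moreover have "(\<Prod>a\<in>set w. if P a then c else 1) = c ^ card {a \<in> set w. P a}"
    for P and c :: 'a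
    by (simp flip: prod.inter_filter)
  ultimately show ?thesis
    by (simp add: word_weight_def node_weight_def prod.distrib)
qed

lemma Q_poly_eq_total_weight:
  "Q_poly n x y z p q r s t = total_weight (node_weight x y z p q r s t) {1..n}"
  unfolding Q_poly_def total_weight_def stirling_perms_eq
  by (intro sum.cong refl word_weight_node_weight[symmetric]) auto

text \<open>Each word contributes one factor \<open>k\<close> for every label in
  \<open>L\<close>.\<close>

lemma total_weight_scale:
  assumes "finite L"
  shows "total_weight (\<lambda>a b c. k * \<phi> a b c) L = k ^ card L * total_weight \<phi> L"
  unfolding total_weight_def sum_distrib_left
  using stirling_wordD(3)[OF _ assms]
  by (intro sum.cong refl) (simp add: word_weight_def prod.distrib)

section \<open>The two identities\<close>

theorem theorem5:
  fixes n :: nat and x y z p q r s t :: "'a::field_char_0"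
  assumes "n \<ge> 1"
    and "x \<noteq> 0" and "y \<noteq> 0" and "z \<noteq> 0" and "x + y + z \<noteq> 0"
  shows "Q_poly n x y z p q r s t =
           ((x + y + z) / 3) ^ n *
           Q_poly n 1 1 1
             (3 * x * y * p / (x + y + z))
             (3 * x * z * q / (x + y + z))
             (3 * y * z * r / (x + y + z))
             (s * (x + y + z) ^ 2 / (9 * x * y * z))
             (3 * t / (x + y + z))
       \<and> C_poly n x y z =
           (\<Sum>w\<in>stirling_perms n.
              (x * y) ^ lap w * (x * z) ^ eud w * (y * z) ^ rpd w *
              (x * y * z) powi (- int (apd w)) *
              ((x + y + z) / 3) powi alpha n w)"
proof
  define k where "k = (x + y + z) / 3"
  have k: "k \<noteq> 0" "x + y + z = 3 * k" using assms by (simp_all add: k_def)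
  \<comment> \<open>The node weight of the right-hand side; the prefactor \<open>k ^ n\<close> is
    spread over the word as one factor \<open>k\<close> per letter.\<close>
  let ?\<psi> = "\<lambda>p q r s t. node_weight 1 1 1 (3 * x * y * p / (x + y + z))
    (3 * x * z * q / (x + y + z)) (3 * y * z * r / (x + y + z))
    (s * (x + y + z) ^ 2 / (9 * x * y * z)) (3 * t / (x + y + z))"
  have Q: "Q_poly n x y z p q r s t =
           ((x + y + z) / 3) ^ n *
           Q_poly n 1 1 1
             (3 * x * y * p / (x + y + z))
             (3 * x * z * q / (x + y + z))
             (3 * y * z * r / (x + y + z))
             (s * (x + y + z) ^ 2 / (9 * x * y * z))
             (3 * t / (x + y + z))" for p q r s t
  proof -
    have "total_weight (node_weight x y z p q r s t) {1..n} =
      total_weight (\<lambda>a b c. k * ?\<psi> p q r s t a b c) {1..n}"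
    proof (rule total_weight_cong_cyclic)
      fix a b c
      \<comment> \<open>For a node with exactly one type, the three rotations contribute
        \<open>x\<close>, \<open>y\<close> and \<open>z\<close> on the left and three times their
        mean on the right.\<close>
      have sum_eq: "x + (y + z) = k * 3" using k(2) by (simp add: add.assoc mult.commute)
      \<comment> \<open>With two types or none, the weights agree before any rotation.\<close>
      have "k * (3 * x * y * p / (3 * k)) = x * y * p" "k * (3 * x * z * q / (3 * k)) = x * z * q"
        "k * (3 * y * z * r / (3 * k)) = y * z * r" "k * (3 * t / (3 * k)) = t" using k(1) by simp_all
      \<comment> \<open>With all three types, the pairs \<open>p\<close>, \<open>q\<close>,
        \<open>r\<close> together bring in the square of \<open>x * y * z\<close> and three factors
        \<open>k\<close> in the denominator; the argument replacing \<open>s\<close> corrects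
        both.\<close>
      moreover have "k * ((3 * x * y * p / (3 * k)) * (3 * x * z * q / (3 * k)) *
          (3 * y * z * r / (3 * k)) * (s * (3 * k) ^ 2 / (9 * x * y * z))) =
          x * y * z * p * q * r * s"
        using k(1) assms by (simp add: field_simps power2_eq_square)
      ultimately show "node_weight x y z p q r s t a b c + node_weight x y z p q r s t b c a +
          node_weight x y z p q r s t c a b =
          k * ?\<psi> p q r s t a b c + k * ?\<psi> p q r s t b c a + k * ?\<psi> p q r s t c a b"
        unfolding k(2) by (cases a; cases b; cases c) (simp_all add: node_weight_def mult_ac add_ac sum_eq)
    qed auto
    then show ?thesis
      unfolding Q_poly_eq_total_weight k_def
      by (simp only: total_weight_scale finite_atLeastAtMost card_atLeastAtMost diff_Suc_1)
  qed
  then show "Q_poly n x y z p q r s t =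
           ((x + y + z) / 3) ^ n *
           Q_poly n 1 1 1
             (3 * x * y * p / (x + y + z))
             (3 * x * z * q / (x + y + z))
             (3 * y * z * r / (x + y + z))
             (s * (x + y + z) ^ 2 / (9 * x * y * z))
             (3 * t / (x + y + z))" .
  have "C_poly n x y z = Q_poly n x y z 1 1 1 1 1"
    by (simp add: C_poly_def Q_poly_def)
  also have "\<dots> = k ^ n * Q_poly n 1 1 1 (x * y / k) (x * z / k) (y * z / k)
      (k ^ 2 / (x * y * z)) (1 / k)"
    using Q[of 1 1 1 1 1] k
    by (simp add: power_mult_distrib mult_ac)
  also have "\<dots> = (\<Sum>w\<in>stirling_perms n.
              (x * y) ^ lap w * (x * z) ^ eud w * (y * z) ^ rpd w *
              (x * y * z) powi (- int (apd w)) * k powi alpha n w)"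
    unfolding Q_poly_def sum_distrib_left
  proof (rule sum.cong[OF refl])
    fix w
    \<comment> \<open>\<open>alpha\<close> collects the powers of \<open>k\<close>: \<open>n\<close>
      from the prefactor, 2 for each \<open>apd\<close>, and -1 for each \<open>lap\<close>,
      \<open>eud\<close>, \<open>rpd\<close> and \<open>vv\<close>.\<close>
    have "k powi alpha n w =
        k ^ n * (k ^ 2) ^ apd w / k ^ lap w / k ^ eud w / k ^ rpd w / k ^ vv w"
    proof -
      have "k powi (2 * int (apd w)) = (k ^ 2) ^ apd w"
        by (metis power_int_mult power_int_numeral power_int_of_nat)
      then show ?thesis using k by (simp add: alpha_def power_int_diff power_int_add)
    qed
    then show "k ^ n * (1 ^ asc w * 1 ^ plat w * 1 ^ des w * (x * y / k) ^ lap w *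
        (x * z / k) ^ eud w * (y * z / k) ^ rpd w * (k ^ 2 / (x * y * z)) ^ apd w * (1 / k) ^ vv w) =
      (x * y) ^ lap w * (x * z) ^ eud w * (y * z) ^ rpd w *
      (x * y * z) powi (- int (apd w)) * k powi alpha n w"
      using k assms by (simp add: power_divide power_int_minus divide_simps mult_ac)
  qed
  finally show "C_poly n x y z =
           (\<Sum>w\<in>stirling_perms n.
              (x * y) ^ lap w * (x * z) ^ eud w * (y * z) ^ rpd w *
              (x * y * z) powi (- int (apd w)) *
              ((x + y + z) / 3) powi alpha n w)"
    by (simp only: k_def)
qed

end
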